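(* Let $n\ge2$ be an integer, $r>1$ a real number, and $m(x)=\prod_{j=1}^n x_j$. Denote $$\mathscr{D}_{r,n}:=\max_{i=1,\dots,n-1}\Big\{\Big(1+\frac in(r-1)\Big)^n-r^i\Big\},\qquad \mathscr{E}_{r,n}:=1+\frac{r^n-1}{r-1}\left[\frac{n-1}{n}\Big(\frac{r^n-1}{n(r-1)}\Big)^{\frac1{n-1}}-1\right].$$ Then, over $[1,r]^n$, $$\mu\big(\mathcal{G}(\operatorname{cav}_{[1,r]^n}[m])\big)=\mathscr{E}_{r,n},\qquad \mu\big(\mathcal{G}(\operatorname{vex}_{[1,r]^n}[m])\big)=\mathscr{D}_{r,n},\qquad \mu\big(\operatorname{conv}\mathcal{G}_{[1,r]^n}(m)\big)=\max\{\mathscr{D}_{r,n},\mathscr{E}_{r,n}\}.$$ All these maximum errors are attained only at points $(x,w)$ with $x$ in the relative interior of the segment $\operatorname{conv}\{\mathbf 1,r\mathbf 1\}$.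
   Context: $\mathbf 1\in\mathbb{R}^n$ is the all-ones vector. For a set $X\subseteq\mathbb{R}^n\times\mathbb{R}$, $\mu(X):=\max_{(x,w)\in X}|w-m(x)|$. For a set $S$, $\mathcal{G}_S(g)=\{(x,w)\in S\times\mathbb{R}\mid w=g(x)\}$ is the graph of $g$ over $S$. $\operatorname{vex}_S[m]$ and $\operatorname{cav}_S[m]$ are the convex and concave envelopes of $m$ over $S$ (the pointwise supremum of all convex underestimators, respectively the pointwise infimum of all concave overestimators, of $m$ on $S$), and $\mathcal{G}(\operatorname{vex}_S[m])$, $\mathcal{G}(\operatorname{cav}_S[m])$ are their graphs over $S$. *)

theory Defs
  imports "HOL-Analysis.Analysis"
begin

definition monomial :: "real ^ 'n::finite \<Rightarrow> real" where
  "monomial x = (\<Prod>j\<in>UNIV. x $ j)"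

definition graph_on :: "'a set \<Rightarrow> ('a \<Rightarrow> real) \<Rightarrow> ('a \<times> real) set" where
  "graph_on S g = {(x, w). x \<in> S \<and> w = g x}"

text \<open>Suprema and infima are real-valued, so the two envelopes are meaningful only at points
  of \<^term>\<open>S\<close> and only if \<^term>\<open>f\<close> has a convex underestimator, respectively a concave
  overestimator, on \<^term>\<open>S\<close> (for instance, if \<^term>\<open>S\<close> is convex and \<^term>\<open>f\<close> is bounded
  on it).\<close>

definition vex :: "'a::real_vector set \<Rightarrow> ('a \<Rightarrow> real) \<Rightarrow> 'a \<Rightarrow> real" where
  "vex S f x = Sup {h x | h. convex_on S h \<and> (\<forall>y\<in>S. h y \<le> f y)}"

definition cav :: "'a::real_vector set \<Rightarrow> ('a \<Rightarrow> real) \<Rightarrow> 'a \<Rightarrow> real" where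
  "cav S f x = Inf {h x | h. concave_on S h \<and> (\<forall>y\<in>S. f y \<le> h y)}"

definition error_at :: "('a \<Rightarrow> real) \<Rightarrow> 'a \<times> real \<Rightarrow> real" where
  "error_at f p = \<bar>snd p - f (fst p)\<bar>"

text \<open>The maximum of the error is rendered as a supremum. It is a genuine maximum exactly when
  the set of maximizers below is nonempty.\<close>

definition mu :: "('a \<Rightarrow> real) \<Rightarrow> ('a \<times> real) set \<Rightarrow> real" where
  "mu f X = (SUP p\<in>X. error_at f p)"

definition maximizers :: "('a \<Rightarrow> real) \<Rightarrow> ('a \<times> real) set \<Rightarrow> ('a \<times> real) set" where
  "maximizers f X = {p \<in> X. \<forall>q\<in>X. error_at f q \<le> error_at f p}"

definition D_err :: "real \<Rightarrow> nat \<Rightarrow> real" where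
  "D_err r n = Max ((\<lambda>i. (1 + real i / real n * (r - 1)) ^ n - r ^ i) ` {1..n - 1})"

definition E_err :: "real \<Rightarrow> nat \<Rightarrow> real" where
  "E_err r n = 1 + (r ^ n - 1) / (r - 1) *
     ((real n - 1) / real n * ((r ^ n - 1) / (real n * (r - 1))) powr (1 / (real n - 1)) - 1)"

end

theory Submission
  imports Defs
begin

text \<open>Every error bound is obtained from an affine minorant or majorant of the monomial.

  If \<open>(r - 1) s\<close> is the sum of the \<open>x\<^sub>j - 1\<close> and \<open>i \<le> s \<le> i + 1\<close>, the chord of \<open>k \<mapsto> r ^ k\<close>
  over \<open>{i, i + 1}\<close>, as a function of \<open>s\<close>, is a minorant. By AM-GM its gap at \<open>x\<close> is at most the
  gap at the diagonal point with the same \<open>s\<close>, which is convex in \<open>s\<close> and hence largest at an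
  integer.

  If \<open>z\<^sub>0 \<ge> \<dots> \<ge> z\<^sub>n\<^sub>-\<^sub>1\<close> are the sorted coordinates of \<open>x\<close>, the affine function
  \<open>1 + \<Sum>k<n. r ^ k * (z\<^sub>k - 1)\<close> is a majorant. For \<open>y\<close> the geometric mean of the coordinates,
  \<open>\<Sum>k<n. r ^ k * (z\<^sub>k - y) \<le> 0\<close>, so the gap at \<open>x\<close> is at most the gap at the diagonal point
  \<open>y 1\<close>, a concave function of \<open>y\<close> whose maximum is \<^const>\<open>E_err\<close>.

  Both bounds are strict off the diagonal, both gaps vanish at its endpoints, and both maxima are
  attained at points of the convex hull of the graph, which lies between the two envelopes.\<close>

section \<open>Bernoulli-type, affine and mean inequalities\<close>

text \<open>Bernoulli for the exponent \<open>n - 1\<close>, multiplied by \<open>t\<close>, leaves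
  the surplus \<open>(n - 1) * (t - 1) ^ 2\<close>, which gives strictness. This makes
  \<open>E_err\<close> a strict maximum and \<open>D_err\<close> positive.\<close>

lemma power_gt_tangent:
  fixes t :: real
  assumes "t > 0" "t \<noteq> 1" "n \<ge> 2"
  shows "1 + real n * (t - 1) < t ^ n"
proof -
  obtain k where n: "n = Suc k" "k \<ge> 1"
    using assms by (cases n) auto
  have "1 + real k * (t - 1) \<le> t ^ k"
    using Bernoulli_inequality[of "t - 1" k] assms by simp
  then have "t * (1 + real k * (t - 1)) \<le> t ^ n"
    using assms n by simp
  moreover have "t * (1 + real k * (t - 1)) = 1 + real n * (t - 1) + real k * (t - 1) ^ 2"
    by (simp add: n algebra_simps power2_eq_square)
  moreover have "real k * (t - 1) ^ 2 > 0"
    using assms n by simp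
  ultimately show ?thesis
    by linarith
qed

text \<open>By convexity of \<open>k \<mapsto> r ^ k\<close>: the left side is the line through its
  values at \<open>i\<close> and \<open>i + 1\<close>. For \<open>k < i\<close> Bernoulli is applied
  to \<open>1 / r\<close>, using \<open>1 - (r - 1) \<le> 1 / r\<close>.\<close>

lemma exponential_tangent_le:
  fixes r :: real
  assumes "r \<ge> 1"
  shows "r ^ i * (1 + (r - 1) * (real k - real i)) \<le> r ^ k"
proof (cases "i \<le> k")
  case True
  then have "1 + (r - 1) * (real k - real i) \<le> r ^ (k - i)"
    using Bernoulli_inequality[of "r - 1" "k - i"] assms
    by (simp add: of_nat_diff mult.commute)
  then have "r ^ i * (1 + (r - 1) * (real k - real i)) \<le> r ^ i * r ^ (k - i)"
    using assms by (intro mult_left_mono) auto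
  also have "\<dots> = r ^ k"
    using True by (simp flip: power_add)
  finally show ?thesis .
next
  case False
  define d where "d = i - k"
  have d: "i = k + d"
    using False by (simp add: d_def)
  have "1 - (r - 1) \<le> 1 / r"
    using assms mult_nonneg_nonneg[of "r - 1" "r - 1"] by (simp add: field_simps)
  then have "1 - real d * (r - 1) \<le> 1 + real d * (1 / r - 1)"
    using mult_left_mono[of "1 - r" "1 / r - 1" "real d"] by (simp add: algebra_simps)
  also have "\<dots> \<le> (1 / r) ^ d"
    using Bernoulli_inequality[of "1 / r - 1" d] assms by simp
  finally have "r ^ d * (1 - real d * (r - 1)) \<le> r ^ d * (1 / r) ^ d"
    using assms by (intro mult_left_mono) auto
  also have "\<dots> = 1"
    using assms by (simp add: power_one_over)
  finally have "r ^ k * (r ^ d * (1 - real d * (r - 1))) \<le> r ^ k"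
    using assms by (simp add: mult_left_le)
  then show ?thesis
    by (simp add: d power_add algebra_simps)
qed

text \<open>Both sides are affine in each \<^term>\<open>z j\<close> separately, so the inequality propagates from
  the vertices of the box one coordinate at a time; \<^term>\<open>k\<close> counts the coordinates
  already set to \<^term>\<open>r\<close>.\<close>

lemma affine_le_prod:
  fixes r :: real and z :: "'a \<Rightarrow> real"
  assumes "r > 1" "finite J" "\<And>j. j \<in> J \<Longrightarrow> 1 \<le> z j \<and> z j \<le> r"
  shows "r ^ i * (1 + (r - 1) * (real k - real i) + (\<Sum>j\<in>J. z j - 1)) \<le> r ^ k * (\<Prod>j\<in>J. z j)"
  using assms(2,3)
proof (induction J arbitrary: k rule: finite_induct)
  case empty
  then show ?case
    using exponential_tangent_le[of r i k] assms by simp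
next
  case (insert a J)
  define t where "t = (z a - 1) / (r - 1)"
  have z: "z a = 1 + (r - 1) * t"
    using assms(1) by (simp add: t_def)
  have t: "0 \<le> t" "t \<le> 1"
    using insert.prems[of a] assms(1) by (auto simp: t_def divide_simps)
  define L where "L = (\<lambda>k. r ^ i * (1 + (r - 1) * (real k - real i) + (\<Sum>j\<in>J. z j - 1)))"
  define P where "P = (\<Prod>j\<in>J. z j)"
  have IH: "L k \<le> r ^ k * P" for k
    using insert by (auto simp: L_def P_def)
  have "(1 - t) * L k + t * L (Suc k) \<le> (1 - t) * (r ^ k * P) + t * (r ^ Suc k * P)"
    using t IH[of k] IH[of "Suc k"] by (intro add_mono mult_left_mono) auto
  also have "\<dots> = r ^ k * (z a * P)"
    by (simp add: z algebra_simps)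
  also have "(1 - t) * L k + t * L (Suc k) = L k + r ^ i * (z a - 1)"
    by (simp add: L_def z algebra_simps)
  finally show ?case
    using insert by (simp add: L_def P_def algebra_simps)
qed

text \<open>Appending the factor \<open>z n\<close> raises the product by the product of the earlier
  factors times \<open>z n - 1\<close>, and that product is at most \<open>r ^ n\<close>. Each order
  of the coordinates thus yields an affine majorant.\<close>

lemma prod_le_geometric_weighted_sum:
  fixes r :: real and z :: "nat \<Rightarrow> real"
  assumes "\<And>i. i < n \<Longrightarrow> 1 \<le> z i \<and> z i \<le> r"
  shows "(\<Prod>i<n. z i) \<le> 1 + (\<Sum>i<n. r ^ i * (z i - 1))"
  using assms
proof (induction n)
  case (Suc n)
  have "(\<Prod>i<n. z i) \<le> (\<Prod>i<n. r)"
    using Suc.prems by (intro prod_mono) (smt (verit) lessThan_iff less_SucI)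
  then have "(\<Prod>i<n. z i) * (z n - 1) \<le> r ^ n * (z n - 1)"
    using Suc.prems by (intro mult_right_mono) auto
  then show ?case
    using Suc by (simp add: algebra_simps)
qed simp

text \<open>This is \<open>ln u \<le> u - 1\<close> at \<open>u = y / z\<close>, with equality only
  for \<open>u = 1\<close>. It trades differences from \<open>y\<close> for logarithms, whose sum
  vanishes when \<open>y\<close> is the geometric mean.\<close>

lemma diff_le_mult_ln:
  fixes z y :: real
  assumes "z > 0" "y > 0"
  shows "z - y \<le> z * ln (z / y)" and "z \<noteq> y \<Longrightarrow> z - y < z * ln (z / y)"
proof -
  have ln: "z * ln (z / y) = - (z * ln (y / z))"
    using assms by (simp add: ln_div algebra_simps)
  have "ln (y / z) \<le> y / z - 1"
    using assms by (intro ln_le_minus_one) simp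
  then have "z * ln (y / z) \<le> z * (y / z - 1)"
    using assms by (intro mult_left_mono) auto
  then show "z - y \<le> z * ln (z / y)"
    using assms ln by (simp add: algebra_simps)
  assume "z \<noteq> y"
  then have "ln (y / z) < y / z - 1"
    using assms ln_le_minus_one[of "y / z"] ln_eq_minus_one[of "y / z"] by fastforce
  then have "z * ln (y / z) < z * (y / z - 1)"
    using assms by (intro mult_strict_left_mono) auto
  then show "z - y < z * ln (z / y)"
    using assms ln by (simp add: algebra_simps)
qed

text \<open>Let \<^term>\<open>p\<close> be the number of entries that are at least \<^term>\<open>y\<close>. Then each
  summand is at most \<open>r ^ p * ln (z i / y)\<close>, and these bounds add up to 0.\<close>

lemma geometric_weighted_sum_le_geometric_mean:
  fixes r y :: real and z :: "nat \<Rightarrow> real"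
  assumes "r > 1" and z: "\<And>i. i < n \<Longrightarrow> 1 \<le> z i \<and> z i \<le> r"
    and decr: "\<And>i j. i \<le> j \<Longrightarrow> j < n \<Longrightarrow> z j \<le> z i"
    and "y > 0" "(\<Prod>i<n. z i) = y ^ n"
  shows "(\<Sum>i<n. r ^ i * (z i - y)) \<le> 0"
    and "\<exists>i<n. z i \<noteq> y \<Longrightarrow> (\<Sum>i<n. r ^ i * (z i - y)) < 0"
proof -
  define L where "L = (\<lambda>i. ln (z i / y))"
  \<comment> \<open>The disjunct \<open>i = n\<close> makes the least element exist and gives
    \<open>p = n\<close> when no entry is below \<open>y\<close>.\<close>
  define p where "p = (LEAST i. i = n \<or> z i < y)"
  have pn: "p = n \<or> z p < y"
    unfolding p_def by (rule LeastI[of _ n]) simp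
  have p_le: "p \<le> n"
    unfolding p_def by (rule Least_le) simp
  have big: "z i \<ge> y" if "i < p" for i
    using not_less_Least[of i "\<lambda>i. i = n \<or> z i < y"] that by (auto simp: p_def)
  have small: "z i < y" if "p \<le> i" "i < n" for i
    using pn decr[of p i] that by fastforce
  have pos: "z i > 0" if "i < n" for i
    using z[of i] that by linarith
  have "(\<Sum>i<n. L i) = ln (\<Prod>i<n. z i / y)"
    unfolding L_def using pos assms(4) by (subst ln_prod) fastforce+
  also have "(\<Prod>i<n. z i / y) = 1"
    using assms(4,5) by (simp add: prod_dividef)
  finally have sumL: "(\<Sum>i<n. r ^ p * L i) = 0"
    by (simp flip: sum_distrib_left)
  have term_le: "r ^ i * (z i - y) \<le> r ^ p * L i \<and> (z i \<noteq> y \<longrightarrow> r ^ i * (z i - y) < r ^ p * L i)"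
    if i: "i < n" for i
  proof (cases "i < p")
    case True
    have "L i \<ge> 0"
      using big[OF True] assms(4) by (simp add: L_def)
    \<comment> \<open>The bound \<open>z i \<le> r\<close> costs one factor \<open>r\<close>, which
      is affordable because \<open>i < p\<close> gives \<open>Suc i \<le> p\<close>.\<close>
    then have "r ^ i * (z i * L i) \<le> r ^ i * (r * L i)"
      using z[OF i] assms(1) by (intro mult_left_mono mult_right_mono) auto
    also have "\<dots> = r ^ Suc i * L i"
      by simp
    also have "\<dots> \<le> r ^ p * L i"
      using True assms(1) \<open>L i \<ge> 0\<close> by (intro mult_right_mono power_increasing) auto
    finally have *: "r ^ i * (z i * L i) \<le> r ^ p * L i" .
    have "r ^ i > 0"
      using assms(1) by simp
    then show ?thesis
      using * diff_le_mult_ln[OF pos[OF i] assms(4)]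
      by (metis L_def mult_le_cancel_left_pos mult_less_cancel_left_pos order_less_le_trans order_trans)
  next
    case False
    have s: "z i < y"
      using small False i by simp
    have "L i \<le> 0"
      using s pos[OF i] assms(4) by (simp add: L_def)
    \<comment> \<open>Here the logarithm is nonpositive, so it is the lower bound
      \<open>1 \<le> z i\<close> that removes the factor \<open>z i\<close>.\<close>
    then have "z i * L i \<le> L i"
      using z[OF i] mult_right_mono_neg[of 1 "z i" "L i"] by simp
    then have "z i - y < L i"
      using diff_le_mult_ln(2)[OF pos[OF i] assms(4)] s by (simp add: L_def)
    then have "r ^ p * (z i - y) < r ^ p * L i"
      using assms(1) by simp
    moreover have "r ^ i * (z i - y) \<le> r ^ p * (z i - y)"
      using False assms(1) s by (intro mult_right_mono_neg power_increasing) auto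
    ultimately show ?thesis
      by linarith
  qed
  show "(\<Sum>i<n. r ^ i * (z i - y)) \<le> 0"
    using term_le sum_mono[of "{..<n}" "\<lambda>i. r ^ i * (z i - y)" "\<lambda>i. r ^ p * L i"] sumL by simp
  show "(\<Sum>i<n. r ^ i * (z i - y)) < 0" if "\<exists>i<n. z i \<noteq> y"
  proof -
    have "(\<Sum>i<n. r ^ i * (z i - y)) < (\<Sum>i<n. r ^ p * L i)"
      using term_le that by (intro sum_strict_mono_ex1) auto
    then show ?thesis
      by (simp add: sumL)
  qed
qed

text \<open>Summing \<open>ln u \<le> u - 1\<close> over the ratios \<open>u = z j / a\<close> gives
  0 on the right; an entry different from \<open>a\<close> makes its summand strict.\<close>

lemma prod_le_arithmetic_mean:
  fixes z :: "'a \<Rightarrow> real"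
  assumes "finite J" "J \<noteq> {}" and z: "\<And>j. j \<in> J \<Longrightarrow> z j > 0"
    and a: "a = (\<Sum>j\<in>J. z j) / card J"
  shows "(\<Prod>j\<in>J. z j) \<le> a ^ card J"
    and "\<exists>j\<in>J. z j \<noteq> a \<Longrightarrow> (\<Prod>j\<in>J. z j) < a ^ card J"
proof -
  have card: "card J > 0"
    using assms by (simp add: card_gt_0_iff)
  have "a > 0"
    unfolding a using assms card by (intro divide_pos_pos sum_pos) auto
  have "(\<Sum>j\<in>J. z j / a - 1) = (\<Sum>j\<in>J. z j) / a - card J"
    by (simp add: sum_subtractf flip: sum_divide_distrib)
  also have "\<dots> = 0"
    using \<open>a > 0\<close> card by (simp add: a field_simps split: if_splits)
  finally have sum0: "(\<Sum>j\<in>J. z j / a - 1) = 0" .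
  have ln: "ln ((\<Prod>j\<in>J. z j) / a ^ card J) = (\<Sum>j\<in>J. ln (z j / a))"
    using \<open>a > 0\<close> z assms(1) by (subst ln_prod[symmetric]) (fastforce simp: prod_dividef)+
  have pos: "(\<Prod>j\<in>J. z j) / a ^ card J > 0"
    using \<open>a > 0\<close> z by (intro divide_pos_pos prod_pos) auto
  have le: "ln (z j / a) \<le> z j / a - 1" if "j \<in> J" for j
    using z[OF that] \<open>a > 0\<close> by (intro ln_le_minus_one) simp
  have "(\<Sum>j\<in>J. ln (z j / a)) \<le> 0"
    using sum_mono[of J "\<lambda>j. ln (z j / a)" "\<lambda>j. z j / a - 1", OF le] sum0 by simp
  then show "(\<Prod>j\<in>J. z j) \<le> a ^ card J"
    using pos \<open>a > 0\<close> by (simp flip: ln)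
  assume "\<exists>j\<in>J. z j \<noteq> a"
  then obtain j where j: "j \<in> J" "z j \<noteq> a" ..
  then have "ln (z j / a) < z j / a - 1"
    using le[of j] ln_eq_minus_one[of "z j / a"] z[of j] \<open>a > 0\<close> by fastforce
  then have "(\<Sum>j\<in>J. ln (z j / a)) < (\<Sum>j\<in>J. z j / a - 1)"
    using j le assms(1) by (intro sum_strict_mono_ex1) auto
  then show "(\<Prod>j\<in>J. z j) < a ^ card J"
    using pos \<open>a > 0\<close> by (simp add: sum0 flip: ln)
qed

section \<open>The two error constants\<close>

text \<open>The maximized function is the gap on the diagonal between the chord from 1 to
  \<open>r\<close> and \<open>y ^ n\<close>. It vanishes at 1 and \<open>r\<close>, so its strict
  maximizer is neither of them and its maximum is positive.\<close>

lemma E_err_maximum: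
  fixes r :: real
  assumes "r > 1" "n \<ge> 2" and K: "K = (r ^ n - 1) / (r - 1)"
  obtains c where "1 < c" "c < r" "E_err r n = 1 + K * (c - 1) - c ^ n" "E_err r n > 0"
    "\<And>y. y > 0 \<Longrightarrow> 1 + K * (y - 1) - y ^ n \<le> E_err r n"
proof -
  \<comment> \<open>The stationary point: \<open>n * c ^ (n - 1) = K\<close>.\<close>
  define c where "c = (K / n) powr (1 / (real n - 1))"
  define f where "f = (\<lambda>y. 1 + K * (y - 1) - y ^ n)"
  have Ksum: "K = (\<Sum>i<n. r ^ i)"
    using assms(1) by (simp add: K geometric_sum)
  \<comment> \<open>\<open>K\<close> is a sum of \<open>n\<close> powers between 1 and
    \<open>r ^ (n - 1)\<close>, so \<open>c ^ (n - 1)\<close>, their average, places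
    \<open>c\<close> between 1 and \<open>r\<close>.\<close>
  have "K \<ge> (\<Sum>i<n. 1)"
    unfolding Ksum using assms(1) by (intro sum_mono) auto
  then have "K \<ge> n"
    by simp
  have "K \<le> (\<Sum>i<n. r ^ (n - 1))"
    unfolding Ksum using assms(1) by (intro sum_mono power_increasing) auto
  then have "K \<le> n * r ^ (n - 1)"
    by simp
  have "K > 0"
    using \<open>K \<ge> n\<close> assms(2) by linarith
  have "c > 0"
    using \<open>K > 0\<close> assms(2) by (simp add: c_def)
  have cpow: "c ^ (n - 1) = K / n"
    using \<open>K > 0\<close> assms(2) by (simp add: c_def powr_powr of_nat_diff flip: powr_realpow)
  then have cn: "c ^ n = c * K / n"
    using assms(2) by (simp add: power_eq_if)
  have fc: "E_err r n = f c"
  proof -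
    have "((r ^ n - 1) / (real n * (r - 1))) powr (1 / (real n - 1)) = c"
      by (simp add: c_def K mult.commute)
    then have "E_err r n = 1 + K * ((real n - 1) / real n * c - 1)"
      by (simp add: E_err_def K)
    also have "\<dots> = f c"
      using assms(2) by (simp add: f_def cn field_simps)
    finally show ?thesis .
  qed
  have strict: "f y < f c" if "y > 0" "y \<noteq> c" for y
  proof -
    \<comment> \<open>The tangent of the power function at \<open>c\<close>, rescaled to the point
      1; its slope is \<open>K\<close> by the choice of \<open>c\<close>.\<close>
    have "1 + real n * (y / c - 1) < (y / c) ^ n"
      using that \<open>c > 0\<close> assms(2) by (intro power_gt_tangent) auto
    then have "c ^ n * (1 + real n * (y / c - 1)) < c ^ n * (y / c) ^ n"
      using \<open>c > 0\<close> by (intro mult_strict_left_mono) auto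
    also have "c ^ n * (y / c) ^ n = y ^ n"
      using \<open>c > 0\<close> by (simp add: power_divide)
    also have "c ^ n * (1 + real n * (y / c - 1)) = c ^ n + K * (y - c)"
      using \<open>c > 0\<close> assms(2) by (simp add: cn field_simps)
    finally show ?thesis
      by (simp add: f_def algebra_simps)
  qed
  have f1: "f 1 = 0" and fr: "f r = 0"
    using assms(1) by (auto simp: f_def K)
  have "c \<noteq> 1" "c \<noteq> r"
    using strict[of 1] strict[of r] f1 fr assms(1) by auto
  moreover have "c \<ge> 1"
  proof (rule ccontr)
    assume "\<not> c \<ge> 1"
    then have "c ^ (n - 1) < 1"
      using \<open>c > 0\<close> assms(2) by (subst power_less_one_iff) auto
    then show False
      using cpow \<open>K \<ge> n\<close> assms(2) mult_strict_left_mono[of "c ^ (n - 1)" 1 "real n"] by simp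
  qed
  moreover have "c \<le> r"
  proof (rule ccontr)
    assume "\<not> c \<le> r"
    then have "r ^ (n - 1) < c ^ (n - 1)"
      using assms(1,2) by (intro power_strict_mono) auto
    then show False
      using cpow \<open>K \<le> n * r ^ (n - 1)\<close> assms(2)
        mult_strict_left_mono[of "r ^ (n - 1)" "c ^ (n - 1)" "real n"] by simp
  qed
  ultimately have "1 < c" "c < r"
    by auto
  moreover have "E_err r n > 0"
    using strict[of 1] f1 fc \<open>c \<noteq> 1\<close> by simp
  moreover have "f y \<le> E_err r n" if "y > 0" for y
    using strict[OF that] fc by (cases "y = c") auto
  ultimately show thesis
    using that fc by (simp add: f_def)
qed

lemma D_err_ge:
  assumes "1 \<le> i" "i \<le> n - 1"
  shows "(1 + real i / real n * (r - 1)) ^ n - r ^ i \<le> D_err r n"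
  unfolding D_err_def using assms by (intro Max_ge) auto

lemma D_err_attained:
  assumes "n \<ge> 2"
  obtains i where "1 \<le> i" "i \<le> n - 1" "D_err r n = (1 + real i / real n * (r - 1)) ^ n - r ^ i"
proof -
  have "D_err r n \<in> (\<lambda>i. (1 + real i / real n * (r - 1)) ^ n - r ^ i) ` {1..n - 1}"
    unfolding D_err_def using assms by (intro Max_in) auto
  then show thesis
    using that by auto
qed

lemma D_err_pos:
  assumes "n \<ge> 2" "r > 1"
  shows "D_err r n > 0"
proof -
  have "1 + real n * ((1 + 1 / n * (r - 1)) - 1) < (1 + 1 / n * (r - 1)) ^ n"
    using assms by (intro power_gt_tangent add_pos_pos mult_pos_pos) auto
  then have "(1 + real 1 / real n * (r - 1)) ^ n - r ^ 1 > 0"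
    using assms by simp
  then show ?thesis
    using D_err_ge[of 1 n r] assms by linarith
qed

text \<open>On an interval between consecutive integers the left-hand side is convex in \<^term>\<open>s\<close>,
  so it is largest at the endpoints.\<close>

lemma power_minus_chord_le_D_err:
  fixes r s :: real
  assumes "n \<ge> 2" "r > 1" "i < n" "real i \<le> s" "s \<le> real (Suc i)"
  shows "(1 + s / n * (r - 1)) ^ n - r ^ i * (1 + (r - 1) * (s - i)) \<le> D_err r n"
proof -
  define P where "P = (\<lambda>s. (1 + s / n * (r - 1)) ^ n)"
  define t where "t = s - i"
  have t: "0 \<le> t" "t \<le> 1"
    using assms by (auto simp: t_def)
  \<comment> \<open>The indices 0 and \<open>n\<close> are missing from the maximum in
    \<open>D_err\<close>; there the difference is 0, so positivity of \<open>D_err\<close> covers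
    them.\<close>
  have ends: "P (real k) - r ^ k \<le> D_err r n" if "k \<le> n" for k
  proof -
    have "k = 0 \<or> k = n \<or> 1 \<le> k \<and> k \<le> n - 1"
      using that by linarith
    then show ?thesis
      using D_err_pos[OF assms(1,2)] D_err_ge[of k n r] assms(1) by (auto simp: P_def)
  qed
  have conv: "convex_on {0..} (\<lambda>x::real. x ^ n)"
    using convex_power_even[of n] convex_power_odd[of n] by (cases "even n") (auto intro: convex_on_subset)
  have "1 + s / n * (r - 1) = (1 - t) *\<^sub>R (1 + i / n * (r - 1)) + t *\<^sub>R (1 + Suc i / n * (r - 1))"
    using assms(1) by (simp add: t_def field_simps)
  then have "P s \<le> (1 - t) * P i + t * P (Suc i)"
    unfolding P_def using convex_onD[OF conv, of t "1 + i / n * (r - 1)" "1 + Suc i / n * (r - 1)"] t assms(2)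
    by simp
  also have "\<dots> - r ^ i * (1 + (r - 1) * t) = (1 - t) * (P i - r ^ i) + t * (P (Suc i) - r ^ Suc i)"
    by (simp add: algebra_simps)
  also have "\<dots> \<le> D_err r n"
    using t ends[of i] ends[of "Suc i"] assms(3) by (intro convex_bound_le) auto
  finally show ?thesis
    by (simp add: P_def t_def)
qed


section \<open>Cyclic shifts, affine functions, envelopes and hulls of graphs\<close>

text \<open>The inverse is the shift by \<open>n - a mod n\<close>. Used to average over all
  rotations of a vertex of the box.\<close>

lemma bij_betw_cyclic_shift:
  "bij_betw (\<lambda>k. (a + k) mod n) {..<n} {..<n}" for a n :: nat
proof (rule bij_betw_byWitness[where f' = "\<lambda>k. ((n - a mod n) + k) mod n"])
  have less: "a mod n < n" if "k \<in> {..<n}" for k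
    using that by simp
  show "\<forall>k\<in>{..<n}. ((n - a mod n) + (a + k) mod n) mod n = k"
  proof
    fix k assume k: "k \<in> {..<n}"
    then have "((n - a mod n) + (a + k) mod n) mod n = ((n - a mod n) + (a mod n + k)) mod n"
      by (metis mod_add_left_eq mod_add_right_eq)
    also have "(n - a mod n) + (a mod n + k) = n + k"
      using less[OF k] by linarith
    finally show "((n - a mod n) + (a + k) mod n) mod n = k"
      using k by simp
  qed
  show "\<forall>k\<in>{..<n}. (a + ((n - a mod n) + k) mod n) mod n = k"
  proof
    fix k assume k: "k \<in> {..<n}"
    then have "(a + ((n - a mod n) + k) mod n) mod n = (a mod n + ((n - a mod n) + k)) mod n"
      by (metis mod_add_left_eq mod_add_right_eq)
    also have "a mod n + ((n - a mod n) + k) = n + k"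
      using less[OF k] by linarith
    finally show "(a + ((n - a mod n) + k) mod n) mod n = k"
      using k by simp
  qed
qed auto

lemma convex_on_affine:
  fixes S :: "(real ^ 'n::finite) set"
  assumes "convex S"
  shows "convex_on S (\<lambda>z. c + (\<Sum>j\<in>UNIV. v j * (z $ j - 1)))"
proof -
  have "c + (\<Sum>j\<in>UNIV. v j * ((s *\<^sub>R x + t *\<^sub>R y) $ j - 1))
      = s * (c + (\<Sum>j\<in>UNIV. v j * (x $ j - 1))) + t * (c + (\<Sum>j\<in>UNIV. v j * (y $ j - 1)))"
    if "s + t = 1" for s t :: real and x y :: "real ^ 'n"
  proof -
    have s: "s = 1 - t"
      using that by simp
    have "(\<Sum>j\<in>UNIV. v j * ((s *\<^sub>R x + t *\<^sub>R y) $ j - 1))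
        = (\<Sum>j\<in>UNIV. s * (v j * (x $ j - 1)) + t * (v j * (y $ j - 1)))"
      by (intro sum.cong refl) (simp add: s algebra_simps)
    then show ?thesis
      by (simp only: sum.distrib flip: sum_distrib_left) (simp add: s algebra_simps)
  qed
  then show ?thesis
    using assms by (simp add: convex_on_def)
qed

lemma concave_on_affine:
  fixes S :: "(real ^ 'n::finite) set"
  assumes "convex S"
  shows "concave_on S (\<lambda>z. c + (\<Sum>j\<in>UNIV. v j * (z $ j - 1)))"
  using convex_on_affine[OF assms, of "- c" "\<lambda>j. - v j"]
  by (simp add: concave_on_def sum_negf)

text \<open>The epigraph of \<open>h\<close> is convex and contains the graph of \<open>f\<close>,
  hence also its hull.\<close>

lemma convex_minorant_le_hull_graph:
  assumes "convex_on S h" "\<And>y. y \<in> S \<Longrightarrow> h y \<le> f y" "(x, w) \<in> convex hull (graph_on S f)"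
  shows "h x \<le> w"
proof -
  have "graph_on S f \<subseteq> epigraph S h"
    using assms(2) by (auto simp: graph_on_def epigraph_def)
  then have "(x, w) \<in> epigraph S h"
    using hull_minimal convex_epigraphI[OF assms(1)] assms(3) by blast
  then show "h x \<le> w"
    by (auto simp: epigraph_def)
qed

text \<open>The same argument with the hypograph of \<open>h\<close>, whose convexity is proved
  directly.\<close>

lemma hull_graph_le_concave_majorant:
  assumes "concave_on S h" "\<And>y. y \<in> S \<Longrightarrow> f y \<le> h y" "(x, w) \<in> convex hull (graph_on S f)"
  shows "w \<le> h x"
proof -
  have "convex {(y, v). y \<in> S \<and> v \<le> h y}"
  proof (clarsimp simp: convex_def)
    fix y y' v v' and s t :: real
    assume *: "y \<in> S" "v \<le> h y" "y' \<in> S" "v' \<le> h y'" "0 \<le> s" "0 \<le> t" "s + t = 1"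
    then have "s * v + t * v' \<le> s * h y + t * h y'"
      by (intro add_mono mult_left_mono)
    then show "s *\<^sub>R y + t *\<^sub>R y' \<in> S \<and> s * v + t * v' \<le> h (s *\<^sub>R y + t *\<^sub>R y')"
      using * assms(1) convexD[of S y y' s t]
      unfolding concave_on_iff by (meson order_trans)
  qed
  moreover have "graph_on S f \<subseteq> {(y, v). y \<in> S \<and> v \<le> h y}"
    using assms(2) by (auto simp: graph_on_def)
  ultimately have "(x, w) \<in> {(y, v). y \<in> S \<and> v \<le> h y}"
    using hull_minimal assms(3) by blast
  then show ?thesis
    by auto
qed

text \<open>The given \<open>h\<close> makes the set under the supremum nonempty, and
  \<open>f x\<close> bounds it above. A hull point over \<open>x\<close> bounds it too, since it
  lies above every convex minorant.\<close>

lemma vex_bounds: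
  assumes "convex_on S h" "\<And>y. y \<in> S \<Longrightarrow> h y \<le> f y" "x \<in> S"
  shows "h x \<le> vex S f x" and "vex S f x \<le> f x"
    and "(x, w) \<in> convex hull (graph_on S f) \<Longrightarrow> vex S f x \<le> w"
proof -
  let ?A = "{h x | h. convex_on S h \<and> (\<forall>y\<in>S. h y \<le> f y)}"
  have "h x \<in> ?A"
    using assms by blast
  moreover have "a \<le> f x" if "a \<in> ?A" for a
    using that assms(3) by blast
  ultimately show "h x \<le> vex S f x" "vex S f x \<le> f x"
    unfolding vex_def by (auto intro!: cSup_upper cSup_least bdd_aboveI)
  assume "(x, w) \<in> convex hull (graph_on S f)"
  then have "a \<le> w" if "a \<in> ?A" for a
    using that convex_minorant_le_hull_graph by blast
  then show "vex S f x \<le> w"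
    unfolding vex_def using \<open>h x \<in> ?A\<close> by (intro cSup_least) auto
qed

lemma cav_bounds:
  assumes "concave_on S h" "\<And>y. y \<in> S \<Longrightarrow> f y \<le> h y" "x \<in> S"
  shows "cav S f x \<le> h x" and "f x \<le> cav S f x"
    and "(x, w) \<in> convex hull (graph_on S f) \<Longrightarrow> w \<le> cav S f x"
proof -
  let ?A = "{h x | h. concave_on S h \<and> (\<forall>y\<in>S. f y \<le> h y)}"
  have "h x \<in> ?A"
    using assms by blast
  moreover have "f x \<le> a" if "a \<in> ?A" for a
    using that assms(3) by blast
  ultimately show "cav S f x \<le> h x" "f x \<le> cav S f x"
    unfolding cav_def by (auto intro!: cInf_lower cInf_greatest bdd_belowI)
  assume "(x, w) \<in> convex hull (graph_on S f)"
  then have "w \<le> a" if "a \<in> ?A" for a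
    using that hull_graph_le_concave_majorant by blast
  then show "w \<le> cav S f x"
    unfolding cav_def using \<open>h x \<in> ?A\<close> by (intro cInf_greatest) auto
qed

text \<open>A bound \<open>M\<close> reached at \<open>q\<close> turns the supremum into a maximum,
  and the maximizers are then exactly the points with error \<open>M\<close>.\<close>

lemma mu_maximizersI:
  assumes "\<And>p. p \<in> X \<Longrightarrow> error_at f p \<le> M" "\<And>p. p \<in> X \<Longrightarrow> error_at f p = M \<Longrightarrow> fst p \<in> I"
    and "q \<in> X" "error_at f q \<ge> M"
  shows "mu f X = M \<and> maximizers f X \<noteq> {} \<and> (\<forall>(x, w)\<in>maximizers f X. x \<in> I)"
proof -
  have q: "error_at f q = M"
    using assms(1)[OF assms(3)] assms(4) by simp
  have "mu f X = M"
    unfolding mu_def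
  proof (rule cSup_eq_maximum)
    show "M \<in> error_at f ` X"
      using assms(3) q by blast
  qed (use assms(1) in auto)
  moreover have "q \<in> maximizers f X"
    using assms(1,3) q by (auto simp: maximizers_def)
  moreover have "x \<in> I" if "(x, w) \<in> maximizers f X" for x w
  proof -
    have "(x, w) \<in> X" "M \<le> error_at f (x, w)"
      using that assms(3) q by (auto simp: maximizers_def)
    then show ?thesis
      using assms(1,2)[of "(x, w)"] by simp
  qed
  ultimately show ?thesis
    by auto
qed

lemma diagonal_in_rel_interior:
  assumes "1 < c" "c < r"
  shows "c *\<^sub>R (1 :: real ^ 'n::finite) \<in> rel_interior (convex hull {1, r *\<^sub>R 1})"
proof -
  define t where "t = (c - 1) / (r - 1)"
  have t: "0 < t" "t < 1" "c = (1 - t) + t * r"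
    using assms by (auto simp: t_def divide_simps) (simp add: algebra_simps)
  have "(1 :: real ^ 'n) \<noteq> r *\<^sub>R 1"
    using assms by (auto simp: vec_eq_iff)
  moreover have "c *\<^sub>R (1 :: real ^ 'n) = (1 - t) *\<^sub>R 1 + t *\<^sub>R r *\<^sub>R 1"
    by (subst t(3)) (simp add: scaleR_add_left scaleR_diff_left)
  ultimately have "c *\<^sub>R (1 :: real ^ 'n) \<in> open_segment 1 (r *\<^sub>R 1)"
    using t by (auto simp: in_segment)
  then show ?thesis
    using \<open>1 \<noteq> r *\<^sub>R 1\<close> by (simp add: rel_interior_closed_segment flip: segment_convex_hull)
qed

section \<open>Affine minorants and majorants of the monomial on the box\<close>

context
  fixes r :: real and S :: "(real ^ 'n::finite) set" and n :: nat
  assumes n: "n = CARD('n)" "n \<ge> 2" and r: "r > 1"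
    and S: "S = cbox 1 (r *\<^sub>R 1)"
begin

lemma mem_box_iff: "x \<in> S \<longleftrightarrow> (\<forall>j. 1 \<le> x $ j \<and> x $ j \<le> r)"
  by (simp add: S mem_box_cart)

lemma convex_S: "convex S"
  by (simp add: S convex_box)

text \<open>The minorant may depend on \<open>x\<close>: the convex envelope and all hull points
  over \<open>x\<close> lie above each choice, so one good choice per point bounds both
  errors.\<close>

lemma convex_minorant_monomial:
  assumes x: "x \<in> S"
  obtains h where "convex_on S h" "\<forall>y\<in>S. h y \<le> monomial y"
    "monomial x - h x \<le> D_err r n"
    "monomial x - h x = D_err r n \<longrightarrow> x \<in> rel_interior (convex hull {1, r *\<^sub>R 1})"
proof -
  define h where "h = (\<lambda>i (z :: real ^ 'n). r ^ i * (1 - (r - 1) * real i) + (\<Sum>j\<in>UNIV. r ^ i * (z $ j - 1)))"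
  have h_le: "h i y \<le> monomial y" if "y \<in> S" for i y
    using affine_le_prod[of r UNIV "\<lambda>j. y $ j" i 0] r that
    by (simp add: h_def monomial_def mem_box_iff distrib_left flip: sum_distrib_left)
  define s where "s = (\<Sum>j\<in>UNIV. x $ j - 1) / (r - 1)"
  have sum: "(\<Sum>j\<in>UNIV. x $ j - 1) = (r - 1) * s"
    using r by (simp add: s_def)
  have h_x: "h i x = r ^ i * (1 + (r - 1) * (s - i))" for i
    by (simp only: h_def sum flip: sum_distrib_left) (simp add: algebra_simps)
  \<comment> \<open>The mean of the coordinates of \<open>x\<close>, so that
    \<open>a *\<^sub>R 1\<close> is the diagonal point with the same \<open>s\<close>.\<close>
  define a where "a = 1 + s / n * (r - 1)"
  have a: "a = (\<Sum>j\<in>UNIV. x $ j) / card (UNIV :: 'n set)"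
    using r n by (simp add: a_def s_def sum_subtractf field_simps)
  have m_le: "monomial x \<le> a ^ n" and m_less: "\<exists>j. x $ j \<noteq> a \<Longrightarrow> monomial x < a ^ n"
  proof -
    have "x $ j > 0" for j
      using x by (smt (verit) mem_box_iff)
    note AM_GM = prod_le_arithmetic_mean[of UNIV "\<lambda>j. x $ j" a, OF _ _ this a]
    show "monomial x \<le> a ^ n" "\<exists>j. x $ j \<noteq> a \<Longrightarrow> monomial x < a ^ n"
      using AM_GM by (auto simp: monomial_def n(1))
  qed
  have "s \<ge> 0"
    unfolding s_def using x r by (intro divide_nonneg_pos sum_nonneg) (auto simp: mem_box_iff)
  have "(\<Sum>j\<in>UNIV. x $ j - 1) \<le> (\<Sum>j\<in>(UNIV :: 'n set). r - 1)"
    using x by (intro sum_mono) (auto simp: mem_box_iff)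
  then have "s \<le> n"
    using r by (simp add: s_def n divide_simps mult.commute)
  \<comment> \<open>The floor of \<open>s\<close>, lowered to \<open>n - 1\<close> at
    \<open>s = n\<close> so that the chord from \<open>i\<close> to \<open>i + 1\<close> stays
    within the range from 0 to \<open>n\<close>.\<close>
  define i where "i = (if s = n then n - 1 else nat \<lfloor>s\<rfloor>)"
  have i: "i < n" "real i \<le> s" "s \<le> real (Suc i)"
    using \<open>s \<ge> 0\<close> \<open>s \<le> n\<close> n(2) unfolding i_def by (auto simp: of_nat_diff) linarith+
  have gap: "a ^ n - h i x \<le> D_err r n"
    unfolding a_def h_x using n r i by (intro power_minus_chord_le_D_err) auto
  show thesis
  proof (rule that[of "h i"])
    show "convex_on S (h i)"
      unfolding h_def by (intro convex_on_affine convex_S)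
    show "monomial x - h i x \<le> D_err r n"
      using gap m_le by linarith
    show "monomial x - h i x = D_err r n \<longrightarrow> x \<in> rel_interior (convex hull {1, r *\<^sub>R 1})"
    proof
      assume eq: "monomial x - h i x = D_err r n"
      then have xa: "x $ j = a" for j
        using gap m_less by fastforce
      then have x_eq: "x = a *\<^sub>R 1"
        by (simp add: vec_eq_iff)
      \<comment> \<open>At both ends of the diagonal the chord meets the monomial, so the gap is 0
        and cannot equal the positive \<open>D_err\<close>.\<close>
      have "a \<noteq> 1"
      proof
        assume "a = 1"
        then have "s = 0"
          using r n by (simp add: a_def)
        then have "i = 0"
          using n by (simp add: i_def)
        then have "monomial x - h i x = 0"
          using \<open>a = 1\<close> \<open>s = 0\<close> by (simp add: h_x monomial_def xa)
        then show False
          using D_err_pos[OF n(2) r] eq by simp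
      qed
      moreover have "a \<noteq> r"
      proof
        assume "a = r"
        then have "(s / n - 1) * (r - 1) = 0"
          by (simp add: a_def algebra_simps)
        then have "s = n"
          using r n by simp
        then have "i = n - 1" "s - i = 1"
          using n by (auto simp: i_def)
        then have "monomial x - h i x = 0"
          using \<open>a = r\<close> n r power_minus_mult[of "CARD('n)" r] by (simp add: h_x monomial_def xa)
        then show False
          using D_err_pos[OF n(2) r] eq by simp
      qed
      ultimately have "1 < a" "a < r"
        using x xa by (auto simp: mem_box_iff less_le)
      then show "x \<in> rel_interior (convex hull {1, r *\<^sub>R 1})"
        unfolding x_eq by (rule diagonal_in_rel_interior)
    qed
  qed (use h_le in auto)
qed

text \<open>The majorant is the affine piece of the Lovasz extension of \<^const>\<open>monomial\<close> that is
  active at \<^term>\<open>x\<close>: \<open>xs\<close> lists the coordinates of \<^term>\<open>x\<close> in decreasing order.\<close>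

lemma concave_majorant_monomial:
  assumes x: "x \<in> S"
  obtains h where "concave_on S h" "\<forall>y\<in>S. monomial y \<le> h y"
    "h x - monomial x \<le> E_err r n"
    "h x - monomial x = E_err r n \<longrightarrow> x \<in> rel_interior (convex hull {1, r *\<^sub>R 1})"
proof -
  obtain xs0 :: "'n list" where xs0: "set xs0 = UNIV" "distinct xs0"
    using finite_distinct_list[of "UNIV :: 'n set"] by auto
  define xs where "xs = sort_key (\<lambda>j. - x $ j) xs0"
  have xs: "set xs = UNIV" "distinct xs"
    using xs0 by (auto simp: xs_def)
  have len: "length xs = n"
    using distinct_card[OF xs(2)] xs(1) n(1) by simp
  have bij: "bij_betw (\<lambda>k. xs ! k) {..<n} UNIV"
    using bij_betw_nth[OF xs(2)] xs(1) len by simp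
  have decr: "x $ (xs ! j) \<le> x $ (xs ! i)" if "i \<le> j" "j < n" for i j
    using sorted_nth_mono[of "map (\<lambda>j. - x $ j) xs" i j] that len by (simp add: xs_def)
  define h where "h = (\<lambda>z :: real ^ 'n. 1 + (\<Sum>k<n. r ^ k * (z $ (xs ! k) - 1)))"
  \<comment> \<open>The position of a coordinate in \<open>xs\<close>. Reindexing by it writes
    \<open>h\<close> as a sum over coordinates, the form for which concavity of affine functions was
    proved.\<close>
  define rk where "rk = inv_into {..<n} (\<lambda>k. xs ! k)"
  have h_alt: "h = (\<lambda>z. 1 + (\<Sum>j\<in>UNIV. r ^ rk j * (z $ j - 1)))"
  proof
    fix z
    have "(\<Sum>j\<in>UNIV. r ^ rk j * (z $ j - 1)) = (\<Sum>k<n. r ^ rk (xs ! k) * (z $ (xs ! k) - 1))"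
      by (rule sum.reindex_bij_betw[OF bij, symmetric])
    also have "\<dots> = (\<Sum>k<n. r ^ k * (z $ (xs ! k) - 1))"
      using bij by (intro sum.cong) (auto simp: rk_def bij_betw_def)
    finally show "h z = 1 + (\<Sum>j\<in>UNIV. r ^ rk j * (z $ j - 1))"
      by (simp add: h_def)
  qed
  have mon: "monomial z = (\<Prod>k<n. z $ (xs ! k))" for z
    unfolding monomial_def by (rule prod.reindex_bij_betw[OF bij, symmetric])
  define K where "K = (r ^ n - 1) / (r - 1)"
  have K: "K = (\<Sum>k<n. r ^ k)"
    using r by (simp add: K_def geometric_sum)
  have E: "E_err r n > 0" "\<And>y. y > 0 \<Longrightarrow> 1 + K * (y - 1) - y ^ n \<le> E_err r n"
    by (rule E_err_maximum[OF r n(2) K_def]; blast)+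
  have m_pos: "monomial x > 0"
    unfolding monomial_def using x by (intro prod_pos) (smt (verit) mem_box_iff)
  define y where "y = root n (monomial x)"
  have y: "y > 0" "y ^ n = monomial x"
    using m_pos n(2) by (auto simp: y_def)
  \<comment> \<open>Each \<open>x $ (xs ! k) - 1\<close> is split at the geometric mean
    \<open>y\<close>: the first part is the gap at the diagonal point, the remaining sum is
    nonpositive.\<close>
  have h_x: "h x - monomial x = 1 + K * (y - 1) - y ^ n + (\<Sum>k<n. r ^ k * (x $ (xs ! k) - y))"
  proof -
    have "(\<Sum>k<n. r ^ k * (x $ (xs ! k) - 1)) = (\<Sum>k<n. r ^ k * (y - 1) + r ^ k * (x $ (xs ! k) - y))"
      by (intro sum.cong) (auto simp: algebra_simps)
    then show ?thesis
      by (simp add: h_def y K sum.distrib flip: sum_distrib_right)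
  qed
  have z: "1 \<le> x $ (xs ! k) \<and> x $ (xs ! k) \<le> r" for k
    using x by (simp add: mem_box_iff)
  note rearr = geometric_weighted_sum_le_geometric_mean
    [of r n "\<lambda>k. x $ (xs ! k)" y, OF r z decr y(1), folded mon, OF _ _ y(2)[symmetric]]
  show thesis
  proof (rule that[of h])
    show "concave_on S h"
      unfolding h_alt by (intro concave_on_affine convex_S)
    show "\<forall>z\<in>S. monomial z \<le> h z"
      unfolding mon h_def by (intro ballI prod_le_geometric_weighted_sum) (simp add: mem_box_iff)
    show "h x - monomial x \<le> E_err r n"
      using rearr(1) E(2)[OF y(1)] h_x by simp
    show "h x - monomial x = E_err r n \<longrightarrow> x \<in> rel_interior (convex hull {1, r *\<^sub>R 1})"
    proof
      assume eq: "h x - monomial x = E_err r n"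
      then have "\<forall>k<n. x $ (xs ! k) = y"
        using rearr(2) E(2)[OF y(1)] h_x by fastforce
      then have xy: "x $ j = y" for j
        using xs(1) len by (metis UNIV_I in_set_conv_nth)
      then have x_eq: "x = y *\<^sub>R 1"
        by (simp add: vec_eq_iff)
      have "1 + K * (y - 1) - y ^ n > 0"
        using eq E(1) h_x xy by simp
      then have "y \<noteq> 1" "y \<noteq> r"
        using r by (auto simp: K_def)
      then have "1 < y" "y < r"
        using x xy by (auto simp: mem_box_iff less_le)
      then show "x \<in> rel_interior (convex hull {1, r *\<^sub>R 1})"
        unfolding x_eq by (rule diagonal_in_rel_interior)
    qed
  qed
qed

section \<open>Hull points that attain the bounds\<close>

text \<open>The points \<open>(c 1, r ^ i)\<close>, with \<open>c\<close> the mean of \<open>i\<close> entries \<open>r\<close> and \<open>n - i\<close> entries 1,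
  are averages over the cyclic shifts of a vertex, hence lie in the hull of the graph.\<close>

lemma vertex_average_in_hull:
  assumes "i \<le> n"
  shows "((1 + real i / n * (r - 1)) *\<^sub>R 1, r ^ i) \<in> convex hull (graph_on S monomial)"
proof -
  obtain e :: "'n \<Rightarrow> nat" where e: "bij_betw e UNIV {..<n}"
    using ex_bij_betw_finite_nat[of "UNIV :: 'n set"] n(1) by (auto simp: atLeast0LessThan)
  define f where "f = (\<lambda>k. if k < i then r else 1)"
  have less_i: "{..<n} = {..<i} \<union> {i..<n}"
    using assms by auto
  have sum_f: "(\<Sum>k<n. f k) = n + i * (r - 1)"
    unfolding less_i using assms
    by (subst sum.union_disjoint) (auto simp: f_def of_nat_diff algebra_simps)
  have prod_f: "(\<Prod>k<n. f k) = r ^ i"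
    unfolding less_i by (subst prod.union_disjoint) (auto simp: f_def)
  \<comment> \<open>The \<open>n\<close> rotations of one vertex with \<open>i\<close> entries
    \<open>r\<close>. All have the monomial value \<open>r ^ i\<close>, and each coordinate runs
    through every entry once.\<close>
  define v :: "nat \<Rightarrow> real ^ 'n" where "v = (\<lambda>k. \<chi> j. f ((k + e j) mod n))"
  have m_v: "monomial (v k) = r ^ i" for k
  proof -
    have "monomial (v k) = (\<Prod>a<n. f ((k + a) mod n))"
      unfolding monomial_def v_def using prod.reindex_bij_betw[OF e] by simp
    also have "\<dots> = (\<Prod>a<n. f a)"
      by (rule prod.reindex_bij_betw[OF bij_betw_cyclic_shift])
    finally show ?thesis
      by (simp add: prod_f)
  qed
  have sum_v: "(\<Sum>k<n. v k $ j) = n + i * (r - 1)" for j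
  proof -
    have "(\<Sum>k<n. v k $ j) = (\<Sum>k<n. f ((e j + k) mod n))"
      by (simp add: v_def add.commute)
    also have "\<dots> = (\<Sum>k<n. f k)"
      by (rule sum.reindex_bij_betw[OF bij_betw_cyclic_shift])
    finally show ?thesis
      by (simp add: sum_f)
  qed
  have "v k \<in> S" for k
    using r by (simp add: v_def f_def mem_box_iff)
  then have "(v k, r ^ i) \<in> graph_on S monomial" for k
    by (simp add: graph_on_def m_v)
  then have "(\<Sum>k<n. (1 / n) *\<^sub>R (v k, r ^ i)) \<in> convex hull (graph_on S monomial)"
    using n(2) by (intro convex_sum hull_inc) auto
  also have "(\<Sum>k<n. (1 / n) *\<^sub>R (v k, r ^ i)) = ((1 + real i / n * (r - 1)) *\<^sub>R 1, r ^ i)"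
  proof (rule prod_eqI)
    have "(\<Sum>k<n. (1 / n) *\<^sub>R v k) $ j = 1 + real i / n * (r - 1)" for j
      using sum_v[of j] n(2) by (simp add: field_simps flip: sum_divide_distrib)
    then show "fst (\<Sum>k<n. (1 / n) *\<^sub>R (v k, r ^ i)) = fst ((1 + real i / n * (r - 1)) *\<^sub>R 1, r ^ i)"
      by (simp add: fst_sum vec_eq_iff)
    show "snd (\<Sum>k<n. (1 / n) *\<^sub>R (v k, r ^ i)) = snd ((1 + real i / n * (r - 1)) *\<^sub>R (1 :: real ^ 'n), r ^ i)"
      using n(2) by (simp add: snd_sum)
  qed
  finally show ?thesis .
qed

text \<open>These points form the segment between the graph points over \<open>1\<close> and
  \<open>r *\<^sub>R 1\<close>.\<close>

lemma diagonal_chord_in_hull: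
  assumes "1 \<le> c" "c \<le> r"
  shows "(c *\<^sub>R 1, 1 + (r ^ n - 1) / (r - 1) * (c - 1)) \<in> convex hull (graph_on S monomial)"
proof -
  define t where "t = (c - 1) / (r - 1)"
  have t: "0 \<le> t" "t \<le> 1" "c = 1 - t + t * r"
    using assms r by (auto simp: t_def divide_simps) (simp add: algebra_simps)
  have "(1, 1) \<in> graph_on S monomial" "(r *\<^sub>R 1, r ^ n) \<in> graph_on S monomial"
    using r n(1) by (auto simp: graph_on_def mem_box_iff monomial_def)
  then have "(1 - t) *\<^sub>R (1, 1) + t *\<^sub>R (r *\<^sub>R 1, r ^ n) \<in> convex hull (graph_on S monomial)"
    using t by (intro convexD hull_inc) auto
  moreover have "(1 - t) *\<^sub>R (1, 1) + t *\<^sub>R (r *\<^sub>R 1, r ^ n) = (c *\<^sub>R (1 :: real ^ 'n), 1 + (r ^ n - 1) / (r - 1) * (c - 1))"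
  proof -
    have "1 - t + t * r ^ n = 1 + (r ^ n - 1) * t"
      by (simp add: algebra_simps)
    then show ?thesis
      by (subst t(3)) (simp add: vec_eq_iff t_def)
  qed
  ultimately show ?thesis
    by (simp only:)
qed

lemma E_err_attained:
  obtains x w where "(x, w) \<in> convex hull (graph_on S monomial)" "w - monomial x = E_err r n"
proof -
  obtain c where "1 < c" "c < r" "E_err r n = 1 + (r ^ n - 1) / (r - 1) * (c - 1) - c ^ n"
    using E_err_maximum[OF r n(2) refl] by metis
  then show thesis
    using that[OF diagonal_chord_in_hull[of c]] n(1) by (simp add: monomial_def)
qed

lemma D_err_attained_in_hull:
  obtains x w where "(x, w) \<in> convex hull (graph_on S monomial)" "monomial x - w = D_err r n"
proof -
  obtain i where i: "1 \<le> i" "i \<le> n - 1" "D_err r n = (1 + real i / real n * (r - 1)) ^ n - r ^ i"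
    using D_err_attained[OF n(2)] by metis
  then show thesis
    using that[OF vertex_average_in_hull[of i]] n(1) by (simp add: monomial_def)
qed

section \<open>The three maximum errors\<close>

lemma hull_graph_subset:
  assumes "(x, w) \<in> convex hull (graph_on S monomial)"
  shows "x \<in> S"
proof -
  have "x \<in> fst ` (convex hull (graph_on S monomial))"
    using assms by force
  also have "\<dots> = convex hull (fst ` graph_on S monomial)"
    by (intro convex_hull_linear_image linear_fst)
  also have "fst ` graph_on S monomial = S"
    by (force simp: graph_on_def)
  finally show ?thesis
    by (simp add: convex_S hull_same)
qed

text \<open>The concave envelope at \<open>x\<close> lies between the hull points over
  \<open>x\<close> and the affine majorant chosen for \<open>x\<close>; at the hull point with gap
  \<open>E_err\<close> the two bounds meet.\<close>

lemma cav_error: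
  defines "X \<equiv> graph_on S (cav S monomial)"
  shows "mu monomial X = E_err r n \<and> maximizers monomial X \<noteq> {} \<and>
    (\<forall>(x, w)\<in>maximizers monomial X. x \<in> rel_interior (convex hull {1, r *\<^sub>R 1}))"
proof -
  obtain x w where xw: "(x, w) \<in> convex hull (graph_on S monomial)" "w - monomial x = E_err r n"
    by (rule E_err_attained)
  have *: "monomial x \<le> cav S monomial x \<and> cav S monomial x - monomial x \<le> E_err r n \<and>
      (cav S monomial x - monomial x = E_err r n \<longrightarrow> x \<in> rel_interior (convex hull {1, r *\<^sub>R 1})) \<and>
      ((x, w) \<in> convex hull (graph_on S monomial) \<longrightarrow> w \<le> cav S monomial x)"
    if x: "x \<in> S" for x :: "real ^ 'n" and w
  proof -
    obtain h where h: "concave_on S h" "\<forall>y\<in>S. monomial y \<le> h y"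
      "h x - monomial x \<le> E_err r n"
      "h x - monomial x = E_err r n \<longrightarrow> x \<in> rel_interior (convex hull {1, r *\<^sub>R 1})"
      by (rule concave_majorant_monomial[OF x])
    show ?thesis
      using cav_bounds[OF h(1) h(2)[rule_format] x] h(3,4) by fastforce
  qed
  have x: "x \<in> S"
    using xw hull_graph_subset by blast
  show ?thesis
  proof (rule mu_maximizersI[where q = "(x, cav S monomial x)"])
    show "(x, cav S monomial x) \<in> X"
      using x by (simp add: X_def graph_on_def)
    show "E_err r n \<le> error_at monomial (x, cav S monomial x)"
      using *[OF x, of w] xw by (simp add: error_at_def)
  qed (use * in \<open>auto simp: X_def graph_on_def error_at_def\<close>)
qed

lemma vex_error:
  defines "X \<equiv> graph_on S (vex S monomial)"
  shows "mu monomial X = D_err r n \<and> maximizers monomial X \<noteq> {} \<and>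
    (\<forall>(x, w)\<in>maximizers monomial X. x \<in> rel_interior (convex hull {1, r *\<^sub>R 1}))"
proof -
  obtain x w where xw: "(x, w) \<in> convex hull (graph_on S monomial)" "monomial x - w = D_err r n"
    by (rule D_err_attained_in_hull)
  have *: "vex S monomial x \<le> monomial x \<and> monomial x - vex S monomial x \<le> D_err r n \<and>
      (monomial x - vex S monomial x = D_err r n \<longrightarrow> x \<in> rel_interior (convex hull {1, r *\<^sub>R 1})) \<and>
      ((x, w) \<in> convex hull (graph_on S monomial) \<longrightarrow> vex S monomial x \<le> w)"
    if x: "x \<in> S" for x :: "real ^ 'n" and w
  proof -
    obtain h where h: "convex_on S h" "\<forall>y\<in>S. h y \<le> monomial y"
      "monomial x - h x \<le> D_err r n"
      "monomial x - h x = D_err r n \<longrightarrow> x \<in> rel_interior (convex hull {1, r *\<^sub>R 1})"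
      by (rule convex_minorant_monomial[OF x])
    show ?thesis
      using vex_bounds[OF h(1) h(2)[rule_format] x] h(3,4) by fastforce
  qed
  have x: "x \<in> S"
    using xw hull_graph_subset by blast
  show ?thesis
  proof (rule mu_maximizersI[where q = "(x, vex S monomial x)"])
    show "(x, vex S monomial x) \<in> X"
      using x by (simp add: X_def graph_on_def)
    show "D_err r n \<le> error_at monomial (x, vex S monomial x)"
      using *[OF x, of w] xw by (simp add: error_at_def)
  qed (use * in \<open>auto simp: X_def graph_on_def error_at_def abs_minus_commute\<close>)
qed

text \<open>The two signs of the error are bounded separately, by \<open>D_err\<close> below the
  graph and \<open>E_err\<close> above it; the larger constant supplies the point that attains the
  maximum.\<close>

lemma hull_error:
  defines "X \<equiv> convex hull (graph_on S monomial)"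
  shows "mu monomial X = max (D_err r n) (E_err r n) \<and> maximizers monomial X \<noteq> {} \<and>
    (\<forall>(x, w)\<in>maximizers monomial X. x \<in> rel_interior (convex hull {1, r *\<^sub>R 1}))"
proof -
  have D: "monomial x - w \<le> D_err r n \<and>
      (monomial x - w = D_err r n \<longrightarrow> x \<in> rel_interior (convex hull {1, r *\<^sub>R 1}))"
    if "(x, w) \<in> X" for x w
  proof -
    have "x \<in> S"
      using that hull_graph_subset by (auto simp: X_def)
    then obtain h where h: "convex_on S h" "\<forall>y\<in>S. h y \<le> monomial y"
      "monomial x - h x \<le> D_err r n"
      "monomial x - h x = D_err r n \<longrightarrow> x \<in> rel_interior (convex hull {1, r *\<^sub>R 1})"
      by (rule convex_minorant_monomial)
    show ?thesis
      using convex_minorant_le_hull_graph[OF h(1) h(2)[rule_format] that[unfolded X_def]] h(3,4) by fastforce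
  qed
  have E: "w - monomial x \<le> E_err r n \<and>
      (w - monomial x = E_err r n \<longrightarrow> x \<in> rel_interior (convex hull {1, r *\<^sub>R 1}))"
    if "(x, w) \<in> X" for x w
  proof -
    have "x \<in> S"
      using that hull_graph_subset by (auto simp: X_def)
    then obtain h where h: "concave_on S h" "\<forall>y\<in>S. monomial y \<le> h y"
      "h x - monomial x \<le> E_err r n"
      "h x - monomial x = E_err r n \<longrightarrow> x \<in> rel_interior (convex hull {1, r *\<^sub>R 1})"
      by (rule concave_majorant_monomial)
    show ?thesis
      using hull_graph_le_concave_majorant[OF h(1) h(2)[rule_format] that[unfolded X_def]] h(3,4) by fastforce
  qed
  obtain q where q: "q \<in> X" "max (D_err r n) (E_err r n) \<le> error_at monomial q"
  proof (cases "D_err r n \<le> E_err r n")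
    case True
    obtain x w where "(x, w) \<in> X" "w - monomial x = E_err r n"
      unfolding X_def by (rule E_err_attained)
    then show thesis
      using True that[of "(x, w)"] by (simp add: error_at_def)
  next
    case False
    obtain x w where "(x, w) \<in> X" "monomial x - w = D_err r n"
      unfolding X_def by (rule D_err_attained_in_hull)
    then show thesis
      using False that[of "(x, w)"] by (simp add: error_at_def)
  qed
  show ?thesis
  proof (rule mu_maximizersI[OF _ _ q])
    fix p
    assume "p \<in> X"
    then obtain x w where p: "p = (x, w)" "(x, w) \<in> X"
      by (cases p) auto
    show "error_at monomial p \<le> max (D_err r n) (E_err r n)"
      using D[OF p(2)] E[OF p(2)] by (auto simp: p(1) error_at_def)
    \<comment> \<open>Whichever sign the error has, its one-sided bound must be an equality, since
      neither constant exceeds the maximum.\<close>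
    show "fst p \<in> rel_interior (convex hull {1, r *\<^sub>R 1})"
      if "error_at monomial p = max (D_err r n) (E_err r n)"
      using D[OF p(2)] E[OF p(2)] that
      by (auto simp: p(1) error_at_def abs_if max_def split: if_splits)
  qed
qed

end

theorem theorem1p3:
  fixes r :: real and S :: "(real ^ 'n::finite) set" and n :: nat
  assumes "n = CARD('n)" and "n \<ge> 2" and "r > 1"
    and "S = cbox 1 (r *\<^sub>R 1)"
  shows "mu monomial (graph_on S (cav S monomial)) = E_err r n
    \<and> mu monomial (graph_on S (vex S monomial)) = D_err r n
    \<and> mu monomial (convex hull (graph_on S monomial)) = max (D_err r n) (E_err r n)
    \<and> (\<forall>X \<in> {graph_on S (cav S monomial), graph_on S (vex S monomial),
               convex hull (graph_on S monomial)}.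
           maximizers monomial X \<noteq> {} \<and>
           (\<forall>(x, w) \<in> maximizers monomial X. x \<in> rel_interior (convex hull {1, r *\<^sub>R 1})))"
  using cav_error[OF assms] vex_error[OF assms] hull_error[OF assms] by blast

end
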